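(* Let $F:\mathbb{R}^r\to\mathbb{R}^r$, $F(x)=x\odot x$. Then $F$ is continuously differentiable and $\|\nabla F(x)-\nabla F(y)\|_{\mathrm{op}}\le 2\|x-y\|_2$ for all $x,y\in\mathbb{R}^r$. Moreover, for any given $z^\star\in\mathbb{R}^r_+$ (the nonnegative orthant, zero entries allowed) with $r^\star=\#\operatorname{supp}(z^\star)$, $F$ is weakly aligned at $z^\star$ with the functions $$s(\rho)=\frac{\rho}{\max\{\sqrt{r-r^\star},1\}}\quad\text{and}\quad\delta(\rho)=\min\left\{\min_{\substack{i,j\in[r]\\ z^\star_i\ne z^\star_j}}\frac{|z^\star_i-z^\star_j|}{2},\ \min_{\substack{i\in[r]\\ z^\star_i\ne0}}\frac{z^\star_i}{1+s(\rho)},\ \min_{\substack{i\in[r]\\ z^\star_i\ne0}}\frac{z^\star_i}{2}\right\}.$$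
   Context: $\odot$ is the componentwise product, $[r]=\{1,\dots,r\}$, $\operatorname{supp}(z)$ is the set of indices of nonzero entries of $z$, and $\#$ denotes cardinality. A minimum over an empty set is $+\infty$. $\nabla F(x)$ is the Jacobian. Fix for each $x$ an SVD of $\nabla F(x)$ with singular values $\sigma_1^x\ge\sigma_2^x\ge\cdots$; $\Pi_j^x$ is the orthogonal projection onto the span of the top $j$ left singular vectors of $\nabla F(x)$. $B_t(z)$ is the closed Euclidean ball of radius $t$ around $z$, $\mathbb{R}_+$ (as domain and range of the functions below) the positive reals. $F$ is weakly aligned at $z^\star\in\operatorname{Im}F$ with functions $\delta,s:\mathbb{R}_+\to\mathbb{R}_+$ if for any $\rho>0$ and any $z=F(x)\in B_{\delta(\rho)}(z^\star)$ there is an index $j$ such that $\|(I-\Pi^x_j)(z-z^\star)\|_2\le\rho\|z-z^\star\|_2$ and $(\sigma^x_j)^2\ge s(\rho)\|z-z^\star\|_2$.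
   Formalization: At z*=0, where δ=+∞ is not a positive real and the claim fails for ρ>4 (x=(1,...,1)), the statement allows δ=+∞ and gives the inequalities with j in [r] only for 0<ρ≤4, and for all ρ>0 with index j=0 also allowed (Π_0=0, σ_0=+∞). *)

theory Defs
  imports "HOL-Analysis.Analysis"
begin

definition orth_proj :: "'a::euclidean_space set \<Rightarrow> 'a \<Rightarrow> 'a" where
  "orth_proj S w = (THE p. p \<in> S \<and> (\<forall>q\<in>S. orthogonal (w - p) q))"

(* Thin SVD with p = min(m,n) terms, indexed from 1: A is the sum of sg k * u k * (v k)^T. *)
definition is_svd :: "real^'n^'m \<Rightarrow> (nat \<Rightarrow> real^'m) \<Rightarrow> (nat \<Rightarrow> real) \<Rightarrow> (nat \<Rightarrow> real^'n) \<Rightarrow> bool" where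
  "is_svd A u sg v \<longleftrightarrow>
     (let p = min CARD('m) CARD('n) in
        (\<forall>j\<in>{1..p}. \<forall>k\<in>{1..p}. u j \<bullet> u k = (if j = k then 1 else 0)) \<and>
        (\<forall>j\<in>{1..p}. \<forall>k\<in>{1..p}. v j \<bullet> v k = (if j = k then 1 else 0)) \<and>
        (\<forall>k\<in>{1..p}. 0 \<le> sg k) \<and>
        (\<forall>j\<in>{1..p}. \<forall>k\<in>{1..p}. j \<le> k \<longrightarrow> sg k \<le> sg j) \<and>
        A = (\<chi> a b. \<Sum>k=1..p. sg k * u k $ a * v k $ b))"

definition svd_choice ::
  "(real^'n \<Rightarrow> real^'m) \<Rightarrow> (real^'n \<Rightarrow> nat \<Rightarrow> real^'m) \<Rightarrow> (real^'n \<Rightarrow> nat \<Rightarrow> real)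
     \<Rightarrow> (real^'n \<Rightarrow> nat \<Rightarrow> real^'n) \<Rightarrow> bool" where
  "svd_choice F U Sg V \<longleftrightarrow> (\<forall>x. is_svd (jacobian F (at x)) (U x) (Sg x) (V x))"

definition top_proj :: "(real^'n \<Rightarrow> nat \<Rightarrow> real^'m) \<Rightarrow> real^'n \<Rightarrow> nat \<Rightarrow> real^'m \<Rightarrow> real^'m" where
  "top_proj U x j = orth_proj (span (U x ` {1..j}))"

(* Weak alignment relative to the fixed choice of left singular vectors U and singular values Sg.
   The radius is extended-real only because it is a minimum of possibly empty families; here it
   has to be a positive real. *)
definition weakly_aligned ::
  "(real^'n \<Rightarrow> nat \<Rightarrow> real^'m) \<Rightarrow> (real^'n \<Rightarrow> nat \<Rightarrow> real) \<Rightarrow> (real^'n \<Rightarrow> real^'m) \<Rightarrow> real^'m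
     \<Rightarrow> (real \<Rightarrow> ereal) \<Rightarrow> (real \<Rightarrow> real) \<Rightarrow> bool" where
  "weakly_aligned U Sg F zs \<delta> s \<longleftrightarrow>
     zs \<in> range F \<and>
     (\<forall>\<rho>>0. 0 < \<delta> \<rho> \<and> \<delta> \<rho> < \<infinity> \<and> 0 < s \<rho>) \<and>
     (\<forall>\<rho>>0. \<forall>x. ereal (dist (F x) zs) \<le> \<delta> \<rho> \<longrightarrow>
        (\<exists>j\<in>{1..min CARD('m) CARD('n)}.
           norm ((F x - zs) - top_proj U x j (F x - zs)) \<le> \<rho> * norm (F x - zs) \<and>
           (Sg x j)\<^sup>2 \<ge> s \<rho> * norm (F x - zs)))"

(* Variant for the degenerate target 0, where the radius is infinite: it may be infinite here,
   the tolerances range over R and the indices over I. The index 0 stands for the zero projection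
   with the convention that the 0-th singular value is infinite.
   For x |-> x * x at target 0 with r coordinates and s(rho) = rho / sqrt r, index 0 cannot be
   avoided when rho > 4: at x = (1,...,1) all singular values are 2, whereas
   s(rho) * norm (F x) = rho > 4. *)
definition weakly_aligned_ext ::
  "real set \<Rightarrow> nat set \<Rightarrow>
   (real^'n \<Rightarrow> nat \<Rightarrow> real^'m) \<Rightarrow> (real^'n \<Rightarrow> nat \<Rightarrow> real) \<Rightarrow> (real^'n \<Rightarrow> real^'m) \<Rightarrow> real^'m
     \<Rightarrow> (real \<Rightarrow> ereal) \<Rightarrow> (real \<Rightarrow> real) \<Rightarrow> bool" where
  "weakly_aligned_ext R I U Sg F zs \<delta> s \<longleftrightarrow>
     zs \<in> range F \<and>
     (\<forall>\<rho>\<in>R. 0 < \<delta> \<rho> \<and> 0 < s \<rho>) \<and>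
     (\<forall>\<rho>\<in>R. \<forall>x. ereal (dist (F x) zs) \<le> \<delta> \<rho> \<longrightarrow>
        (\<exists>j\<in>I.
           norm ((F x - zs) - top_proj U x j (F x - zs)) \<le> \<rho> * norm (F x - zs) \<and>
           (j = 0 \<or> (Sg x j)\<^sup>2 \<ge> s \<rho> * norm (F x - zs))))"

definition sq_map :: "real^'r \<Rightarrow> real^'r" where
  "sq_map x = (\<chi> i. x $ i * x $ i)"

definition supp :: "real^'r \<Rightarrow> 'r set" where
  "supp z = {i. z $ i \<noteq> 0}"

definition s_fun :: "real^'r \<Rightarrow> real \<Rightarrow> real" where
  "s_fun zs \<rho> = \<rho> / max (sqrt (real CARD('r) - real (card (supp zs)))) 1"

(* INF over an empty family of ereals is \<infinity>; all families here are finite, so INF is min. *)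
definition delta_fun :: "real^'r \<Rightarrow> real \<Rightarrow> ereal" where
  "delta_fun zs \<rho> =
     min (INF (i, j)\<in>{(i, j). zs $ i \<noteq> zs $ j}. ereal (\<bar>zs $ i - zs $ j\<bar> / 2))
      (min (INF i\<in>{i. zs $ i \<noteq> 0}. ereal (zs $ i / (1 + s_fun zs \<rho>)))
           (INF i\<in>{i. zs $ i \<noteq> 0}. ereal (zs $ i / 2)))"

end

theory Submission
  imports Defs
begin

text \<open>
  The Jacobian of the squaring map at \<open>x\<close> is the diagonal matrix with entries \<open>2 x\<^sub>i\<close>,
  which depends linearly on \<open>x\<close>; this gives differentiability, continuity and the Lipschitz bound.

  For weak alignment, let \<open>A\<close> be a diagonal matrix with diagonal \<open>a\<close>.  Every left singular
  vector of \<open>A\<close> is an eigenvector of the diagonal matrix \<open>A A\<^sup>T\<close>, so its support only meets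
  coordinates \<open>i\<close> with \<open>a\<^sub>i\<^sup>2 = \<sigma>\<^sup>2\<close>.  Hence, although singular vectors are far from
  unique, cutting a singular value decomposition at a threshold, \<open>\<sigma>\<^sub>k\<^sup>2 \<ge> T\<close>, always produces the same
  space: the coordinate subspace of the indices with \<open>a\<^sub>i\<^sup>2 \<ge> T\<close>
  (lemma \<open>diagonal_svd_threshold\<close>).

  With \<open>d\<close> the distance from \<open>z = x \<odot> x\<close> to the target \<open>z\<^sup>\<star>\<close>, the right threshold is
  \<open>T = s(\<rho>) d\<close>: the required lower bound on the singular value then holds by construction,
  and the residual consists of the coordinates with \<open>4 z\<^sub>i < s(\<rho>) d\<close>.  The radius
  forces \<open>z\<^sub>i \<ge> s(\<rho>) d\<close> wherever \<open>z\<^sup>\<star>\<^sub>i \<noteq> 0\<close>, so only the at most \<open>r - r\<^sup>\<star>\<close> coordinates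
  off the support contribute, each by at most \<open>s(\<rho>) d / 4\<close>, and the factor
  \<open>max (sqrt (r - r\<^sup>\<star>)) 1\<close> in \<open>s\<close> absorbs their number.

  The index so obtained is positive as soon as one coordinate passes the threshold.  For a nonzero
  target any coordinate of its support does.  For the target \<open>0\<close> the largest coordinate of
  \<open>z\<close> does if \<open>\<rho> \<le> 4\<close>, since \<open>d \<le> sqrt r * max z\<^sub>i\<close>.
\<close>

section \<open>The derivative of the squaring map\<close>

lemma sq_map_has_derivative:
  fixes x :: "real^'r"
  shows "(sq_map has_derivative (\<lambda>h. \<chi> i. 2 * x $ i * h $ i)) (at x)"
  unfolding has_derivative_componentwise_within[of sq_map]
proof
  fix b :: "real^'r" assume "b \<in> Basis"
  then obtain i where b: "b = axis i 1" by (auto simp: Basis_vec_def)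
  have "((\<lambda>y::real^'r. y $ i * y $ i) has_derivative (\<lambda>h. 2 * x $ i * h $ i)) (at x)"
    by (auto intro!: derivative_eq_intros bounded_linear.has_derivative[OF bounded_linear_vec_nth])
  then show "((\<lambda>y. sq_map y \<bullet> b) has_derivative (\<lambda>h. (\<chi> i. 2 * x $ i * h $ i) \<bullet> b)) (at x)"
    by (simp add: b inner_axis sq_map_def)
qed

lemma jacobian_sq_map:
  fixes x :: "real^'r"
  shows "jacobian sq_map (at x) = (\<chi> i j. if i = j then 2 * x $ i else 0)"
proof -
  have "frechet_derivative sq_map (at x) = (\<lambda>h. \<chi> i. 2 * x $ i * h $ i)"
    using frechet_derivative_at[OF sq_map_has_derivative] by metis
  then show ?thesis
    by (auto simp: jacobian_def matrix_def vec_eq_iff axis_def)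
qed

lemma continuous_on_jacobian_sq_map:
  "continuous_on UNIV (\<lambda>x :: real^'r. jacobian sq_map (at x))"
  unfolding jacobian_sq_map
proof (intro continuous_on_vec_lambda)
  fix i j :: 'r
  show "continuous_on UNIV (\<lambda>x :: real^'r. if i = j then 2 * x $ i else 0)"
    by (cases "i = j") (auto intro!: continuous_intros)
qed

lemma onorm_jacobian_sq_map_diff_le:
  fixes x y :: "real^'r"
  shows "onorm ((*v) (jacobian sq_map (at x) - jacobian sq_map (at y))) \<le> 2 * norm (x - y)"
proof (rule onorm_le)
  fix h :: "real^'r"
  let ?D = "jacobian sq_map (at x) - jacobian sq_map (at y)"
  have coord: "(?D *v h) $ i = 2 * (x - y) $ i * h $ i" for i
  proof -
    have "(?D *v h) $ i = (\<Sum>j\<in>UNIV. if i = j then 2 * (x - y) $ i * h $ i else 0)"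
      unfolding jacobian_sq_map matrix_vector_mult_def vec_lambda_beta
      by (intro sum.cong) (auto simp: algebra_simps)
    then show ?thesis by simp
  qed
  have "norm (?D *v h) \<le> norm ((2 * norm (x - y)) *\<^sub>R h)"
  proof (rule norm_le_componentwise_cart)
    fix i
    have "\<bar>2 * (x - y) $ i\<bar> \<le> 2 * norm (x - y)"
      using component_le_norm_cart[of "x - y" i] by (simp add: abs_mult)
    then have "\<bar>2 * (x - y) $ i\<bar> * \<bar>h $ i\<bar> \<le> 2 * norm (x - y) * \<bar>h $ i\<bar>"
      by (rule mult_right_mono) simp
    then show "norm ((?D *v h) $ i) \<le> norm (((2 * norm (x - y)) *\<^sub>R h) $ i)"
      by (simp add: coord abs_mult)
  qed
  then show "norm (?D *v h) \<le> 2 * norm (x - y) * norm h" by simp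
qed

section \<open>Singular value decompositions of diagonal matrices\<close>

lemma orth_proj_eqI:
  fixes S :: "'a::euclidean_space set"
  assumes S: "subspace S" and p: "p \<in> S" and orth: "\<And>q. q \<in> S \<Longrightarrow> orthogonal (w - p) q"
  shows "orth_proj S w = p"
  unfolding orth_proj_def
proof (rule the_equality)
  show "p \<in> S \<and> (\<forall>q\<in>S. orthogonal (w - p) q)" using p orth by blast
next
  fix p' assume p': "p' \<in> S \<and> (\<forall>q\<in>S. orthogonal (w - p') q)"
  have "p - p' \<in> S" using p p' S by (auto intro: subspace_diff)
  then have "(w - p') \<bullet> (p - p') = 0" "(w - p) \<bullet> (p - p') = 0"
    using p' orth by (auto simp: orthogonal_def)
  then have "(p - p') \<bullet> (p - p') = 0" by (simp add: inner_diff)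
  then show "p' = p" by simp
qed

text \<open>
  Orthonormality of the two families gives \<open>A\<^sup>T u\<^sub>k = \<sigma>\<^sub>k v\<^sub>k\<close> and \<open>A v\<^sub>k = \<sigma>\<^sub>k u\<^sub>k\<close>.  For diagonal
  \<open>A\<close> these are coordinatewise identities, and composing them yields the eigenvector equation
  for \<open>A A\<^sup>T\<close>.
\<close>

lemma diagonal_svd_eigenvector:
  fixes a :: "real^'n"
  assumes svd: "is_svd (\<chi> i j. if i = j then a $ i else 0) u sg v"
    and k: "k \<in> {1..CARD('n)}"
  shows "(a $ i)\<^sup>2 * u k $ i = (sg k)\<^sup>2 * u k $ i"
proof -
  let ?p = "{1..CARD('n)}"
  have entry: "(if b = c then a $ b else 0) = (\<Sum>l\<in>?p. sg l * u l $ b * v l $ c)" for b c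
    using svd by (simp add: is_svd_def Let_def vec_eq_iff)
  have u: "\<And>l. l \<in> ?p \<Longrightarrow> u l \<bullet> u k = (if l = k then 1 else 0)"
    and v: "\<And>l. l \<in> ?p \<Longrightarrow> v l \<bullet> v k = (if l = k then 1 else 0)"
    using svd k by (auto simp: is_svd_def Let_def)
  have "a $ i * v k $ i = (\<Sum>c\<in>UNIV. (if i = c then a $ i else 0) * v k $ c)"
    by (simp add: if_distrib[of "\<lambda>t. t * _"] cong: if_cong)
  also have "\<dots> = (\<Sum>c\<in>UNIV. \<Sum>l\<in>?p. sg l * u l $ i * (v l $ c * v k $ c))"
    by (simp add: entry sum_distrib_right mult.assoc)
  also have "\<dots> = (\<Sum>l\<in>?p. sg l * u l $ i * (v l \<bullet> v k))"
    by (subst sum.swap) (simp add: inner_vec_def sum_distrib_left)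
  also have "\<dots> = sg k * u k $ i"
    using k by (simp add: v if_distrib[of "\<lambda>t. _ * t"] cong: if_cong)
  finally have Av: "a $ i * v k $ i = sg k * u k $ i" .
  have "a $ i * u k $ i = (\<Sum>b\<in>UNIV. (if b = i then a $ b else 0) * u k $ b)"
    by (simp add: if_distrib[of "\<lambda>t. t * _"] cong: if_cong)
  also have "\<dots> = (\<Sum>b\<in>UNIV. \<Sum>l\<in>?p. sg l * v l $ i * (u l $ b * u k $ b))"
    by (simp add: entry sum_distrib_left sum_distrib_right mult_ac)
  also have "\<dots> = (\<Sum>l\<in>?p. sg l * v l $ i * (u l \<bullet> u k))"
    by (subst sum.swap) (simp add: inner_vec_def sum_distrib_left)
  also have "\<dots> = sg k * v k $ i"
    using k by (simp add: u if_distrib[of "\<lambda>t. _ * t"] cong: if_cong)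
  finally have Atu: "a $ i * u k $ i = sg k * v k $ i" .
  have "(a $ i)\<^sup>2 * u k $ i = a $ i * (a $ i * u k $ i)"
    by (simp add: power2_eq_square)
  also have "\<dots> = sg k * (a $ i * v k $ i)" by (simp add: Atu)
  also have "\<dots> = (sg k)\<^sup>2 * u k $ i" by (simp add: Av power2_eq_square)
  finally show ?thesis .
qed

text \<open>
  As many orthonormal vectors as the dimension span the whole space, so Fourier expansion holds.
\<close>

lemma orthonormal_family_expand:
  fixes u :: "nat \<Rightarrow> 'a::euclidean_space"
  assumes u: "\<And>j k. j \<in> {1..DIM('a)} \<Longrightarrow> k \<in> {1..DIM('a)} \<Longrightarrow> u j \<bullet> u k = (if j = k then 1 else 0)"
  shows "(\<Sum>k=1..DIM('a). (w \<bullet> u k) *\<^sub>R u k) = w"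
proof -
  let ?B = "u ` {1..DIM('a)}"
  have inj: "inj_on u {1..DIM('a)}"
    by (rule inj_onI) (metis u zero_neq_one)
  have orth: "pairwise orthogonal ?B"
    by (auto simp: pairwise_def orthogonal_def u)
  have unit: "norm b = 1" if "b \<in> ?B" for b
    using that u by (auto simp: norm_eq_1)
  have "0 \<notin> ?B" using unit by force
  then have indep: "independent ?B"
    using orth pairwise_orthogonal_independent by blast
  have "card ?B = DIM('a)" using card_image[OF inj] by simp
  then have "UNIV \<subseteq> span ?B"
    using indep by (intro card_ge_dim_independent) auto
  then have "(\<Sum>b\<in>?B. (w \<bullet> b) *\<^sub>R b) = w"
    using orthonormal_basis_expand[OF orth, of w] unit by blast
  then show ?thesis by (simp only: sum.reindex[OF inj] o_def)
qed

text \<open>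
  A left singular vector with \<open>\<sigma>\<^sub>k\<^sup>2 \<ge> T\<close> lives on the coordinates with \<open>a\<^sub>i\<^sup>2 \<ge> T\<close>,
  and one with \<open>\<sigma>\<^sub>k\<^sup>2 < T\<close> lives on the others.  The singular vectors form a basis,
  so the former span the full coordinate subspace.  Its orthogonal projection is therefore
  coordinate truncation.  In particular the index cannot be \<open>0\<close> when some coordinate
  survives, because the projection onto the zero space kills everything.
\<close>

lemma diagonal_svd_threshold:
  fixes a :: "real^'n" and T :: real
  assumes svd: "is_svd (\<chi> i j. if i = j then a $ i else 0) u sg v"
  obtains j where "j \<in> {0..CARD('n)}"
    and "\<And>k. k \<in> {1..j} \<Longrightarrow> T \<le> (sg k)\<^sup>2"
    and "\<And>w. orth_proj (span (u ` {1..j})) w = (\<chi> i. if T \<le> (a $ i)\<^sup>2 then w $ i else 0)"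
    and "\<And>i. T \<le> (a $ i)\<^sup>2 \<Longrightarrow> j \<noteq> 0"
proof -
  let ?n = "CARD('n)"
  define K where "K = {k \<in> {1..?n}. T \<le> (sg k)\<^sup>2}"
  define j where "j = card K"
  have ortho: "\<And>k l. k \<in> {1..?n} \<Longrightarrow> l \<in> {1..?n} \<Longrightarrow> u k \<bullet> u l = (if k = l then 1 else 0)"
    and nonneg: "\<And>k. k \<in> {1..?n} \<Longrightarrow> 0 \<le> sg k"
    and decr: "\<And>k l. k \<in> {1..?n} \<Longrightarrow> l \<in> {1..?n} \<Longrightarrow> k \<le> l \<Longrightarrow> sg l \<le> sg k"
    using svd by (auto simp: is_svd_def Let_def)
  have "finite K" by (simp add: K_def)
  have jn: "j \<le> ?n"
    using card_mono[of "{1..?n}" K] by (simp add: j_def K_def subset_eq)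
  \<comment> \<open>The singular values decrease, so those above the threshold come first.\<close>
  have down: "l \<in> K" if "k \<in> K" "l \<in> {1..k}" for k l
  proof -
    have "k \<in> {1..?n}" "l \<in> {1..?n}" "T \<le> (sg k)\<^sup>2" using that by (auto simp: K_def)
    moreover have "(sg k)\<^sup>2 \<le> (sg l)\<^sup>2"
      using calculation that decr[of l k] nonneg[of k] by (intro power_mono) auto
    ultimately show ?thesis by (auto simp: K_def)
  qed
  have K: "K = {1..j}"
  proof (cases "K = {}")
    case True
    then show ?thesis by (simp add: j_def)
  next
    case False
    have "K = {1..Max K}"
    proof
      show "K \<subseteq> {1..Max K}" using \<open>finite K\<close> by (auto simp: K_def)
      show "{1..Max K} \<subseteq> K" using down[OF Max_in[OF \<open>finite K\<close> False]] by blast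
    qed
    then have "card K = Max K" by (metis card_atLeastAtMost diff_Suc_1)
    then show ?thesis using \<open>K = {1..Max K}\<close> by (simp add: j_def)
  qed
  have supp_u: "(a $ i)\<^sup>2 = (sg k)\<^sup>2" if "k \<in> {1..?n}" "u k $ i \<noteq> 0" for k i
    using diagonal_svd_eigenvector[OF svd that(1), of i] that(2) by simp
  have proj: "orth_proj (span (u ` {1..j})) w = (\<chi> i. if T \<le> (a $ i)\<^sup>2 then w $ i else 0)"
    (is "_ = ?p") for w
  proof (rule orth_proj_eqI)
    show "subspace (span (u ` {1..j}))" by (rule subspace_span)
    have "?p \<bullet> u k = 0" if "k \<in> {1..?n}" "k \<notin> {1..j}" for k
      unfolding inner_vec_def
      using supp_u[OF that(1)] that K by (intro sum.neutral) (force simp: K_def)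
    then have "(?p \<bullet> u k) *\<^sub>R u k \<in> span (u ` {1..j})" if "k \<in> {1..?n}" for k
      using that by (cases "k \<in> {1..j}")
        (simp_all only: span_scale span_base span_zero imageI scaleR_zero_left not_False_eq_True)
    then have "(\<Sum>k=1..?n. (?p \<bullet> u k) *\<^sub>R u k) \<in> span (u ` {1..j})"
      by (rule span_sum)
    then show "?p \<in> span (u ` {1..j})"
      using orthonormal_family_expand[of u ?p] ortho by simp
  next
    fix q assume q: "q \<in> span (u ` {1..j})"
    have "(w - ?p) \<bullet> u k = 0" if "k \<in> {1..j}" for k
    proof -
      have k: "k \<in> K" using that K by simp
      then show ?thesis
        unfolding inner_vec_def
        using supp_u[of k] by (intro sum.neutral) (force simp: K_def)
    qed
    then have "orthogonal (w - ?p) y" if "y \<in> u ` {1..j}" for y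
      using that by (auto simp: orthogonal_def)
    then show "orthogonal (w - ?p) q"
      using q orthogonal_to_span by blast
  qed
  have "j \<noteq> 0" if "T \<le> (a $ i)\<^sup>2" for i
  proof
    assume "j = 0"
    have "orth_proj (span {}) (axis i 1 :: real^'n) = 0"
      by (rule orth_proj_eqI) (auto simp: orthogonal_def)
    then have "(\<chi> l. if T \<le> (a $ l)\<^sup>2 then axis i (1::real) $ l else 0) = 0"
      using proj[of "axis i 1"] \<open>j = 0\<close> by simp
    then have "(if T \<le> (a $ i)\<^sup>2 then axis i (1::real) $ i else 0) = 0"
      by (simp only: vec_eq_iff vec_lambda_beta zero_index)
    then show False using that by (simp add: axis_def)
  qed
  moreover have "T \<le> (sg k)\<^sup>2" if "k \<in> {1..j}" for k
    using that unfolding K[symmetric] K_def by simp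
  moreover have "j \<in> {0..?n}" using jn by simp
  ultimately show thesis using that[of j] proj by blast
qed

section \<open>Weak alignment of the squaring map\<close>

lemma sq_map_nonneg_in_range:
  fixes z :: "real^'r"
  assumes "\<forall>i. 0 \<le> z $ i"
  shows "z \<in> range sq_map"
proof
  show "z = sq_map (\<chi> i. sqrt (z $ i))" using assms by (simp add: sq_map_def vec_eq_iff)
qed simp

lemma s_fun_pos: "0 < \<rho> \<Longrightarrow> 0 < s_fun zs \<rho>"
  by (simp add: s_fun_def less_max_iff_disj)

lemma norm_le_sqrt_card_mult:
  fixes y :: "real^'n"
  assumes out: "\<And>i. i \<notin> N \<Longrightarrow> y $ i = 0" and bound: "\<And>i. \<bar>y $ i\<bar> \<le> b"
  shows "norm y \<le> sqrt (card N) * b"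
proof -
  have b: "0 \<le> b" using bound abs_ge_zero order_trans by blast
  have "(norm y)\<^sup>2 = (\<Sum>i\<in>UNIV. (y $ i)\<^sup>2)"
    by (simp add: norm_vec_def L2_set_def sum_nonneg)
  also have "\<dots> = (\<Sum>i\<in>N. (y $ i)\<^sup>2)"
    by (rule sum.mono_neutral_right) (auto simp: out)
  also have "\<dots> \<le> (\<Sum>i\<in>N. b\<^sup>2)"
    using bound b by (intro sum_mono) (simp add: power2_le_iff_abs_le)
  also have "\<dots> = (sqrt (card N) * b)\<^sup>2" by (simp add: power_mult_distrib)
  finally show ?thesis using b by (simp add: power2_le_iff_abs_le)
qed

text \<open>
  The singular value decomposition is cut at \<open>T = s(\<rho>) d\<close>.  The hypothesis on the support of
  the target says that the projection keeps all of its coordinates.  A coordinate that is cut off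
  therefore has target value \<open>0\<close>, and its residual is \<open>x\<^sub>i\<^sup>2 < T / 4\<close>.
\<close>

lemma sq_map_aligned_index:
  fixes zs x :: "real^'r"
  assumes svd: "svd_choice sq_map U Sg V" and \<rho>: "0 < \<rho>"
    and keep: "\<forall>i\<in>supp zs. s_fun zs \<rho> * norm (sq_map x - zs) \<le> (2 * x $ i)\<^sup>2"
  shows "\<exists>j\<in>{0..CARD('r)}.
    norm ((sq_map x - zs) - top_proj U x j (sq_map x - zs)) \<le> \<rho> * norm (sq_map x - zs) \<and>
    (j = 0 \<or> (Sg x j)\<^sup>2 \<ge> s_fun zs \<rho> * norm (sq_map x - zs)) \<and>
    ((\<exists>i. s_fun zs \<rho> * norm (sq_map x - zs) \<le> (2 * x $ i)\<^sup>2) \<longrightarrow> j \<noteq> 0)"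
proof -
  define d where "d = norm (sq_map x - zs)"
  define T where "T = s_fun zs \<rho> * d"
  define M where "M = max (sqrt (real CARD('r) - real (card (supp zs)))) 1"
  have M: "1 \<le> M" by (simp add: M_def)
  have sM: "s_fun zs \<rho> = \<rho> / M" by (simp add: s_fun_def M_def)
  have "is_svd (\<chi> i j. if i = j then (\<chi> l. 2 * x $ l) $ i else 0) (U x) (Sg x) (V x)"
    using svd unfolding svd_choice_def jacobian_sq_map vec_lambda_beta by (rule spec)
  then obtain j where j: "j \<in> {0..CARD('r)}" "\<And>k. k \<in> {1..j} \<Longrightarrow> T \<le> (Sg x k)\<^sup>2"
    and proj: "\<And>w. orth_proj (span (U x ` {1..j})) w = (\<chi> i. if T \<le> ((\<chi> l. 2 * x $ l) $ i)\<^sup>2 then w $ i else 0)"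
    and pos: "\<And>i. T \<le> ((\<chi> l. 2 * x $ l) $ i)\<^sup>2 \<Longrightarrow> j \<noteq> 0"
    by (rule diagonal_svd_threshold[where T = T]) blast
  define R where "R = (sq_map x - zs) - top_proj U x j (sq_map x - zs)"
  have R: "R $ i = (if T \<le> (2 * x $ i)\<^sup>2 then 0 else x $ i * x $ i - zs $ i)" for i
    unfolding R_def top_proj_def proj by (simp add: sq_map_def)
  have T0: "0 \<le> T" using s_fun_pos[OF \<rho>, of zs] by (simp add: T_def d_def)
  have "norm R \<le> sqrt (card (- supp zs)) * (T / 4)"
  proof (rule norm_le_sqrt_card_mult)
    show "R $ i = 0" if "i \<notin> - supp zs" for i
      using that keep by (simp add: R T_def d_def)
    show "\<bar>R $ i\<bar> \<le> T / 4" for i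
    proof (cases "T \<le> (2 * x $ i)\<^sup>2")
      case False
      then have "zs $ i = 0" using keep by (auto simp: T_def d_def supp_def)
      then show ?thesis using False by (simp add: R power2_eq_square)
    qed (use T0 R in simp)
  qed
  also have "\<dots> \<le> M * T"
  proof (rule mult_mono)
    have "real (card (- supp zs)) = real CARD('r) - real (card (supp zs))"
      by (simp add: Compl_eq_Diff_UNIV card_Diff_subset of_nat_diff card_mono)
    then show "sqrt (card (- supp zs)) \<le> M" by (simp add: M_def)
  qed (use T0 M in auto)
  also have "\<dots> = \<rho> * d" using M by (simp add: T_def sM)
  finally have "norm R \<le> \<rho> * d" .
  moreover have "j = 0 \<or> T \<le> (Sg x j)\<^sup>2" using j(2)[of j] by fastforce
  moreover have "(\<exists>i. T \<le> (2 * x $ i)\<^sup>2) \<longrightarrow> j \<noteq> 0" using pos by auto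
  ultimately show ?thesis
    using j(1) unfolding R_def d_def T_def by blast
qed

text \<open>
  Within the radius, \<open>d \<le> z\<^sup>\<star>\<^sub>i / (1 + s)\<close>, so \<open>z\<^sub>i \<ge> z\<^sup>\<star>\<^sub>i - d \<ge> s d\<close>.
\<close>

lemma delta_fun_keeps_support:
  fixes zs x :: "real^'r"
  assumes \<rho>: "0 < \<rho>" and near: "ereal (dist (sq_map x) zs) \<le> delta_fun zs \<rho>"
  shows "\<forall>i\<in>supp zs. s_fun zs \<rho> * norm (sq_map x - zs) \<le> (2 * x $ i)\<^sup>2"
proof
  fix i assume i: "i \<in> supp zs"
  define d where "d = norm (sq_map x - zs)"
  have "delta_fun zs \<rho> \<le> ereal (zs $ i / (1 + s_fun zs \<rho>))"
    unfolding delta_fun_def using i by (intro min.coboundedI2 min.coboundedI1 INF_lower) (simp add: supp_def)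
  then have "ereal d \<le> ereal (zs $ i / (1 + s_fun zs \<rho>))"
    using near order_trans by (fastforce simp: d_def dist_norm)
  then have "d * (1 + s_fun zs \<rho>) \<le> zs $ i"
    using s_fun_pos[OF \<rho>, of zs] by (simp add: pos_le_divide_eq)
  moreover have "\<bar>(sq_map x - zs) $ i\<bar> \<le> d"
    unfolding d_def by (rule component_le_norm_cart)
  ultimately have "s_fun zs \<rho> * d \<le> (x $ i)\<^sup>2"
    by (simp add: sq_map_def power2_eq_square algebra_simps abs_le_iff)
  also have "\<dots> \<le> (2 * x $ i)\<^sup>2" by (simp add: power_mult_distrib)
  finally show "s_fun zs \<rho> * norm (sq_map x - zs) \<le> (2 * x $ i)\<^sup>2" by (simp add: d_def)
qed

lemma INF_ereal_pos:
  assumes "finite A" "\<And>a. a \<in> A \<Longrightarrow> 0 < f a"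
  shows "0 < (INF a\<in>A. ereal (f a))"
  using assms by (cases "A = {}") (auto simp: top_ereal_def finite_less_Inf_iff)

lemma delta_fun_pos:
  fixes zs :: "real^'r"
  assumes "\<forall>i. 0 \<le> zs $ i" "0 < \<rho>"
  shows "0 < delta_fun zs \<rho>"
proof -
  have pos: "0 < zs $ i" if "zs $ i \<noteq> 0" for i
    using assms(1) that by (simp add: order_less_le)
  have "0 < (INF (i, j)\<in>{(i, j). zs $ i \<noteq> zs $ j}. ereal (\<bar>zs $ i - zs $ j\<bar> / 2))"
    using INF_ereal_pos[of "{(i, j). zs $ i \<noteq> zs $ j}" "\<lambda>(i, j). \<bar>zs $ i - zs $ j\<bar> / 2"]
    by (simp add: case_prod_unfold)
  moreover have "0 < (INF i\<in>{i. zs $ i \<noteq> 0}. ereal (zs $ i / (1 + s_fun zs \<rho>)))"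
    using pos s_fun_pos[OF assms(2), of zs] by (intro INF_ereal_pos) (auto intro!: divide_pos_pos)
  moreover have "0 < (INF i\<in>{i. zs $ i \<noteq> 0}. ereal (zs $ i / 2))"
    using pos by (intro INF_ereal_pos) auto
  ultimately show ?thesis by (simp add: delta_fun_def)
qed

lemma delta_fun_finite:
  fixes zs :: "real^'r"
  assumes "zs \<noteq> 0"
  shows "delta_fun zs \<rho> < \<infinity>"
proof -
  obtain i where "zs $ i \<noteq> 0" using assms by (auto simp: vec_eq_iff)
  then have "delta_fun zs \<rho> \<le> ereal (zs $ i / 2)"
    unfolding delta_fun_def by (intro min.coboundedI2 INF_lower) simp
  then show ?thesis by (rule le_less_trans) simp
qed

lemma sq_map_weakly_aligned:
  fixes zs :: "real^'r"
  assumes svd: "svd_choice sq_map U Sg V" and zs: "\<forall>i. 0 \<le> zs $ i" and ne: "zs \<noteq> 0"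
  shows "weakly_aligned U Sg sq_map zs (delta_fun zs) (s_fun zs)"
  unfolding weakly_aligned_def
proof (intro conjI allI impI)
  show "zs \<in> range sq_map" using zs by (rule sq_map_nonneg_in_range)
  show "0 < delta_fun zs \<rho>" if "0 < \<rho>" for \<rho> using zs that by (rule delta_fun_pos)
  show "delta_fun zs \<rho> < \<infinity>" for \<rho> using ne by (rule delta_fun_finite)
  show "0 < s_fun zs \<rho>" if "0 < \<rho>" for \<rho> using that by (rule s_fun_pos)
next
  fix \<rho> :: real and x :: "real^'r"
  assume \<rho>: "0 < \<rho>" and near: "ereal (dist (sq_map x) zs) \<le> delta_fun zs \<rho>"
  note keep = delta_fun_keeps_support[OF \<rho> near]
  obtain i where i: "i \<in> supp zs" using ne by (auto simp: vec_eq_iff supp_def)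
  from sq_map_aligned_index[OF svd \<rho> keep]
  obtain j where j: "j \<in> {0..CARD('r)}"
    "norm ((sq_map x - zs) - top_proj U x j (sq_map x - zs)) \<le> \<rho> * norm (sq_map x - zs)"
    "j = 0 \<or> (Sg x j)\<^sup>2 \<ge> s_fun zs \<rho> * norm (sq_map x - zs)"
    "(\<exists>i. s_fun zs \<rho> * norm (sq_map x - zs) \<le> (2 * x $ i)\<^sup>2) \<longrightarrow> j \<noteq> 0" by blast
  have "j \<noteq> 0" using j(4) keep i by blast
  then show "\<exists>j\<in>{1..min CARD('r) CARD('r)}.
      norm ((sq_map x - zs) - top_proj U x j (sq_map x - zs)) \<le> \<rho> * norm (sq_map x - zs) \<and>
      (Sg x j)\<^sup>2 \<ge> s_fun zs \<rho> * norm (sq_map x - zs)"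
    using j by (intro bexI[of _ j]) auto
qed

lemma sq_map_weakly_aligned_ext_zero:
  fixes U :: "real^'r \<Rightarrow> nat \<Rightarrow> real^'r"
  assumes svd: "svd_choice sq_map U Sg V"
  shows "weakly_aligned_ext {0<..} {0..CARD('r)} U Sg sq_map 0 (delta_fun (0 :: real^'r)) (s_fun (0 :: real^'r))"
  unfolding weakly_aligned_ext_def
proof (intro conjI ballI allI impI)
  fix \<rho> :: real and x :: "real^'r"
  assume "\<rho> \<in> {0<..}"
  then have "0 < \<rho>" by simp
  have keep: "\<forall>i\<in>supp (0 :: real^'r). s_fun (0 :: real^'r) \<rho> * norm (sq_map x - 0) \<le> (2 * x $ i)\<^sup>2"
    by (simp add: supp_def)
  from sq_map_aligned_index[OF svd \<open>0 < \<rho>\<close> keep]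
  show "\<exists>j\<in>{0..CARD('r)}.
      norm ((sq_map x - 0) - top_proj U x j (sq_map x - 0)) \<le> \<rho> * norm (sq_map x - 0) \<and>
      (j = 0 \<or> (Sg x j)\<^sup>2 \<ge> s_fun (0 :: real^'r) \<rho> * norm (sq_map x - 0))"
    by blast
qed (use sq_map_nonneg_in_range[of 0] delta_fun_pos[of 0] s_fun_pos in auto)

text \<open>
  For \<open>z\<^sup>\<star> = 0\<close> the threshold is \<open>\<rho> \<parallel>z\<parallel> / sqrt r \<le> 4 max z\<^sub>i\<close>, and \<open>4 z\<^sub>i = (2 x\<^sub>i)\<^sup>2\<close>.
\<close>

lemma s_fun_zero_mult_norm_le_max:
  fixes x :: "real^'r"
  assumes \<rho>: "0 < \<rho>" "\<rho> \<le> 4"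
  shows "\<exists>i. s_fun (0 :: real^'r) \<rho> * norm (sq_map x) \<le> (2 * x $ i)\<^sup>2"
proof -
  define m where "m = Max (range (\<lambda>i. (x $ i)\<^sup>2))"
  have "m \<in> range (\<lambda>i. (x $ i)\<^sup>2)" unfolding m_def by (rule Max_in) auto
  then obtain i where i: "m = (x $ i)\<^sup>2" by blast
  have le: "(x $ l)\<^sup>2 \<le> m" for l unfolding m_def by (rule Max_ge) auto
  have "norm (sq_map x) \<le> sqrt (card (UNIV :: 'r set)) * m"
    using le by (intro norm_le_sqrt_card_mult) (auto simp: sq_map_def power2_eq_square)
  moreover have "1 \<le> sqrt (real CARD('r))" by (simp add: Suc_le_eq)
  then have s: "s_fun (0 :: real^'r) \<rho> = \<rho> / sqrt (real CARD('r))"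
    by (simp add: s_fun_def supp_def max_absorb1 del: real_sqrt_ge_1_iff)
  ultimately have "s_fun (0 :: real^'r) \<rho> * norm (sq_map x) \<le> \<rho> / sqrt (real CARD('r)) * (sqrt (real CARD('r)) * m)"
    using \<rho> unfolding s by (intro mult_left_mono) auto
  also have "\<dots> = \<rho> * m" by simp
  also have "\<dots> \<le> 4 * m" using \<rho> i by (intro mult_right_mono) auto
  also have "\<dots> = (2 * x $ i)\<^sup>2" by (simp add: i power_mult_distrib)
  finally show ?thesis by blast
qed

lemma sq_map_weakly_aligned_ext_zero_small:
  fixes U :: "real^'r \<Rightarrow> nat \<Rightarrow> real^'r"
  assumes svd: "svd_choice sq_map U Sg V"
  shows "weakly_aligned_ext {0<..4} {1..CARD('r)} U Sg sq_map 0 (delta_fun (0 :: real^'r)) (s_fun (0 :: real^'r))"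
  unfolding weakly_aligned_ext_def
proof (intro conjI ballI allI impI)
  fix \<rho> :: real and x :: "real^'r"
  assume \<rho>': "\<rho> \<in> {0<..4}"
  then have \<rho>: "0 < \<rho>" "\<rho> \<le> 4" by auto
  obtain i where i: "s_fun (0 :: real^'r) \<rho> * norm (sq_map x) \<le> (2 * x $ i)\<^sup>2"
    using s_fun_zero_mult_norm_le_max[OF \<rho>, of x] by blast
  have keep: "\<forall>i\<in>supp (0 :: real^'r). s_fun (0 :: real^'r) \<rho> * norm (sq_map x - 0) \<le> (2 * x $ i)\<^sup>2"
    by (simp add: supp_def)
  from sq_map_aligned_index[OF svd \<rho>(1) keep]
  obtain j where j: "j \<in> {0..CARD('r)}"
    "norm ((sq_map x - 0) - top_proj U x j (sq_map x - 0)) \<le> \<rho> * norm (sq_map x - 0)"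
    "j = 0 \<or> (Sg x j)\<^sup>2 \<ge> s_fun (0 :: real^'r) \<rho> * norm (sq_map x - 0)"
    "(\<exists>i. s_fun (0 :: real^'r) \<rho> * norm (sq_map x - 0) \<le> (2 * x $ i)\<^sup>2) \<longrightarrow> j \<noteq> 0"
    by blast
  have "j \<noteq> 0" using j(4) i by auto
  then show "\<exists>j\<in>{1..CARD('r)}.
      norm ((sq_map x - 0) - top_proj U x j (sq_map x - 0)) \<le> \<rho> * norm (sq_map x - 0) \<and>
      (j = 0 \<or> (Sg x j)\<^sup>2 \<ge> s_fun (0 :: real^'r) \<rho> * norm (sq_map x - 0))"
    using j by (intro bexI[of _ j]) auto
qed (use sq_map_nonneg_in_range[of 0] delta_fun_pos[of 0] s_fun_pos in auto)

theorem theorem5p1: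
  shows "(sq_map :: real^'r \<Rightarrow> real^'r) differentiable_on UNIV \<and>
    continuous_on UNIV (\<lambda>x :: real^'r. jacobian sq_map (at x)) \<and>
    (\<forall>x y :: real^'r.
       onorm ((*v) (jacobian sq_map (at x) - jacobian sq_map (at y))) \<le> 2 * norm (x - y)) \<and>
    (\<forall>U Sg V. \<forall>zs :: real^'r. svd_choice sq_map U Sg V \<longrightarrow> (\<forall>i. 0 \<le> zs $ i) \<longrightarrow>
       (zs \<noteq> 0 \<longrightarrow> weakly_aligned U Sg sq_map zs (delta_fun zs) (s_fun zs)) \<and>
       (zs = 0 \<longrightarrow>
          weakly_aligned_ext {0<..} {0..CARD('r)} U Sg sq_map zs (delta_fun zs) (s_fun zs) \<and>
          weakly_aligned_ext {0<..4} {1..CARD('r)} U Sg sq_map zs (delta_fun zs) (s_fun zs)))"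
proof -
  have "(sq_map :: real^'r \<Rightarrow> real^'r) differentiable_on UNIV"
    using sq_map_has_derivative by (auto simp: differentiable_on_def differentiable_def)
  then show ?thesis
    using continuous_on_jacobian_sq_map onorm_jacobian_sq_map_diff_le sq_map_weakly_aligned
      sq_map_weakly_aligned_ext_zero sq_map_weakly_aligned_ext_zero_small
    by blast
qed

end
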